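(* Let $N\ge 2$, $1\le M\le N$, $A\in\mathbb{M}_{N\times N}$, $B=(b_1,\dots,b_M)\in\mathbb{M}_{N\times M}$, and consider the linear control system $\dot{x}=Ax+Bu$ with $u=(u_1,\dots,u_M)\in[-1,1]^M$. Assume that the system is normal, i.e. for every column $b_j$ of $B$, $j=1,\dots,M$, $$\mathrm{rank}\,[b_j,Ab_j,\dots,A^{N-1}b_j]=N .$$ For $T>0$ let $\mathcal{R}^T$ be the reachable set from the origin at time $T$. Then for every $T>0$ there exists a constant $\gamma>0$, depending only on $N,M,A,B,T$, such that for all $x,y\in\mathcal{R}^T$ and all $\zeta\in N_{\mathcal{R}^T}(x)$, $$\langle\zeta,y-x\rangle\le-\gamma\,\|\zeta\|\,\|y-x\|^N .$$ Moreover, there exists another constant $\gamma'>0$, depending only on $N,M,A,B,T$, such that for all $T>0$ the ball $B(0,\gamma' T^N)$ is contained in $\mathcal{R}^T$. Finally, the constants $\gamma=\gamma(T)$ and $\gamma'=\gamma'(T)$ are bounded away from zero as $T\to0^+$.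
   Context: $\mathbb{M}_{m\times n}$ denotes the real $m\times n$ matrices; $\|\cdot\|$ and $\langle\cdot,\cdot\rangle$ are the Euclidean norm and inner product. $\mathcal{U}_{ad}$ is the set of measurable controls with values a.e. in $[-1,1]^M$. The reachable set from the origin at time $T$ is $$\mathcal{R}^T=\Big\{\int_0^Te^{A(T-s)}Bu(s)\,ds\ :\ u\in\mathcal{U}_{ad}\Big\}$$ (it is convex and compact). For a closed set $K\subset\mathbb{R}^N$ and $x\in K$, $N_K(x)$ is the proximal normal cone: the set of $v\in\mathbb{R}^N$ such that for some $\sigma\ge0$ one has $\langle v,y-x\rangle\le\sigma\|y-x\|^2$ for all $y\in K$; for convex $K$ it coincides with the normal cone of convex analysis. "Bounded away from zero as $T\to0^+$" means that the constants can be chosen as functions of $T$ with strictly positive liminf as $T\to0^+$. $B(0,r)$ is the ball of radius $r$ centered at $0$. *)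

theory Defs
  imports "HOL-Analysis.Analysis"
begin

(* The library's power A ^ k on real^'n^'n is taken componentwise, so powers with respect
   to the matrix product need their own constant. *)
primrec matrix_power :: "real^'n^'n \<Rightarrow> nat \<Rightarrow> real^'n^'n" where
  "matrix_power A 0 = mat 1"
| "matrix_power A (Suc k) = A ** matrix_power A k"

definition matrix_exp :: "real^'n^'n \<Rightarrow> real^'n^'n" where
  "matrix_exp A = (\<Sum>k. (1 / fact k) *\<^sub>R matrix_power A k)"

(* The N x N matrix [b, A b, ..., A^(N-1) b], N = CARD('n).  Columns are indexed by the
   unordered type 'n, so to_nat_on UNIV (a bijection from 'n onto {..<CARD('n)}) numbers
   them; the choice of numbering only permutes the columns. *)
definition kalman_matrix :: "real^'n^'n \<Rightarrow> real^'n \<Rightarrow> real^'n^'n" where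
  "kalman_matrix A b = (\<chi> i k. (matrix_power A (to_nat_on (UNIV :: 'n set) k) *v b) $ i)"

lemma columns_kalman_matrix:
  fixes A :: "real^'n^'n"
  shows "columns (kalman_matrix A b) = (\<lambda>k. matrix_power A k *v b) ` {..<CARD('n)}"
proof -
  have "range (to_nat_on (UNIV :: 'n set)) = {..<CARD('n)}"
    using to_nat_on_finite[of "UNIV :: 'n set"] by (simp add: bij_betw_def)
  moreover have "column i (kalman_matrix A b) = matrix_power A (to_nat_on (UNIV :: 'n set) i) *v b" for i
    by (simp add: column_def kalman_matrix_def vec_eq_iff)
  ultimately show ?thesis
    by (auto simp: columns_def simp flip: \<open>range _ = _\<close>)
qed

definition normal_system :: "real^'n^'n \<Rightarrow> real^'m^'n \<Rightarrow> bool" where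
  "normal_system A B \<longleftrightarrow> (\<forall>j. rank (kalman_matrix A (column j B)) = CARD('n))"

definition admissible_controls :: "real \<Rightarrow> (real \<Rightarrow> real^'m) set" where
  "admissible_controls T =
     {u. u \<in> borel_measurable (lebesgue_on {0..T}) \<and>
         (AE s in lebesgue_on {0..T}. \<forall>j. u s $ j \<in> {-1..1})}"

definition reachable_set :: "real^'n^'n \<Rightarrow> real^'m^'n \<Rightarrow> real \<Rightarrow> (real^'n) set" where
  "reachable_set A B T =
     {integral\<^sup>L (lebesgue_on {0..T}) (\<lambda>s. matrix_exp ((T - s) *\<^sub>R A) *v (B *v u s)) | u.
        u \<in> admissible_controls T}"

definition proximal_normal_cone :: "'a::real_inner set \<Rightarrow> 'a \<Rightarrow> 'a set" where
  "proximal_normal_cone K x =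
     {v. \<exists>\<sigma>\<ge>0. \<forall>y\<in>K. inner v (y - x) \<le> \<sigma> * (norm (y - x))\<^sup>2}"

(* Only the values c T with T > 0 matter. *)
definition bounded_away_from_zero_at_0 :: "(real \<Rightarrow> real) \<Rightarrow> bool" where
  "bounded_away_from_zero_at_0 c \<longleftrightarrow> Liminf (at_right 0) (\<lambda>T. ereal (c T)) > 0"

end

theory Submission
  imports Defs
begin

text \<open>
  If \<open>\<zeta>\<close> is normal at the endpoint of the control \<open>u\<close>, then \<open>u\<^sub>j\<close> is the sign of the switching
  function \<open>g\<^sub>j s = \<langle>\<zeta>, e\<^bsup>(T - s) A\<^esup> b\<^sub>j\<rangle>\<close> wherever \<open>g\<^sub>j s \<noteq> 0\<close>, so that for a second control \<open>v\<close> with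
  endpoint \<open>y\<close> one gets \<open>\<langle>\<zeta>, y - x\<rangle> = - \<Sum>\<^sub>j \<integral> \<bar>g\<^sub>j\<bar> \<bar>v\<^sub>j - u\<^sub>j\<bar>\<close>, while \<open>\<parallel>y - x\<parallel>\<close> is at most a
  multiple of \<open>\<Sum>\<^sub>j \<integral> \<bar>v\<^sub>j - u\<^sub>j\<bar>\<close>.  By the rank condition, at every time one of
  \<open>g\<^sub>j, g\<^sub>j', \<dots>\<close> up to order \<open>N - 1\<close> is at least a constant times \<open>\<parallel>\<zeta>\<parallel>\<close>; hence the set
  \<open>{\<bar>g\<^sub>j\<bar> < c \<parallel>\<zeta>\<parallel> \<eta>\<^bsup>N-1\<^esup>}\<close> has measure \<open>O(\<eta>)\<close>, and
  \<open>\<integral> \<bar>g\<^sub>j\<bar> \<bar>w\<bar> \<ge> c' \<parallel>\<zeta>\<parallel> (\<integral> \<bar>w\<bar>)\<^sup>N\<close> whenever \<open>\<bar>w\<bar> \<le> 2\<close>.  The choice \<open>w = v\<^sub>j - u\<^sub>j\<close> gives the first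
  inequality, and \<open>w = 1\<close> bounds the support function of the reachable set from below, which gives the
  ball.  All constants for a horizon \<open>T\<^sub>0\<close> also serve every \<open>T \<le> T\<^sub>0\<close>.
\<close>

section \<open>The matrix exponential\<close>

lemma matrix_power_scaleR: "matrix_power (t *\<^sub>R A) k = t ^ k *\<^sub>R matrix_power A k"
  by (induction k) (simp_all add: matrix_scalar_ac scalar_matrix_assoc mult.commute)

lemma matrix_power_commute: "matrix_power A k ** A = A ** matrix_power A k"
  by (induction k) (simp_all add: matrix_mul_assoc[symmetric])

text \<open>Left multiplication by \<open>A\<close> is a bounded linear map on matrices, with some
  constant \<open>K\<close>. The terms are therefore dominated by those of the scalar exponential
  series of \<open>K\<close>, times the norm of the identity.\<close>

lemma summable_matrix_exp:
  fixes A :: "real^'n^'n"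
  shows "summable (\<lambda>k. (1 / fact k) *\<^sub>R matrix_power A k)"
proof -
  have "linear (\<lambda>X :: real^'n^'n. A ** X)"
    by (intro linearI) (simp_all add: matrix_add_ldistrib matrix_scalar_ac scalar_matrix_assoc)
  then have "\<exists>K>0. \<forall>X :: real^'n^'n. norm (A ** X) \<le> norm X * K"
    by (intro bounded_linear.pos_bounded) (simp add: linear_conv_bounded_linear)
  then obtain K where K: "K > 0" "\<And>X :: real^'n^'n. norm (A ** X) \<le> norm X * K"
    by blast
  have *: "norm (matrix_power A k) \<le> K ^ k * norm (mat 1 :: real^'n^'n)" for k
  proof (induction k)
    case (Suc k)
    have "norm (A ** matrix_power A k) \<le> norm (matrix_power A k) * K"
      by (rule K(2))
    also have "\<dots> \<le> (K ^ k * norm (mat 1 :: real^'n^'n)) * K"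
      using Suc K(1) by (intro mult_right_mono) auto
    finally show ?case by (simp add: mult_ac)
  qed simp
  have "summable (\<lambda>k. norm (mat 1 :: real^'n^'n) * (inverse (fact k) * K ^ k))"
    by (intro summable_mult summable_exp)
  then show ?thesis
  proof (rule summable_comparison_test[rotated], intro exI allI impI)
    fix k
    show "norm ((1 / fact k) *\<^sub>R matrix_power A k)
        \<le> norm (mat 1 :: real^'n^'n) * (inverse (fact k) * K ^ k)"
      using *[of k] by (simp add: divide_simps mult_ac)
  qed
qed

lemma matrix_exp_sums: "(\<lambda>k. (t ^ k / fact k) *\<^sub>R matrix_power A k) sums matrix_exp (t *\<^sub>R A)"
  using summable_sums[OF summable_matrix_exp[of "t *\<^sub>R A"]]
  by (simp add: matrix_exp_def matrix_power_scaleR)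

lemma matrix_exp_vector_sums:
  "(\<lambda>k. (t ^ k / fact k) *\<^sub>R (matrix_power A k *v b)) sums (matrix_exp (t *\<^sub>R A) *v b)"
proof -
  have "linear (\<lambda>X. X *v b)"
    by (intro linearI) (simp_all add: matrix_vector_mult_add_rdistrib scaleR_matrix_vector_assoc)
  then show ?thesis
    using bounded_linear.sums[OF _ matrix_exp_sums] linear_conv_bounded_linear
    by (fastforce simp: scaleR_matrix_vector_assoc)
qed

lemma matrix_exp_commute:
  "matrix_exp (t *\<^sub>R A) *v (A *v b) = A *v (matrix_exp (t *\<^sub>R A) *v b)"
proof -
  have "(\<lambda>k. A *v ((t ^ k / fact k) *\<^sub>R (matrix_power A k *v b)))
      sums (A *v (matrix_exp (t *\<^sub>R A) *v b))"
    by (rule bounded_linear.sums[OF matrix_vector_mul_bounded_linear matrix_exp_vector_sums])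
  moreover have "A *v ((t ^ k / fact k) *\<^sub>R (matrix_power A k *v b))
      = (t ^ k / fact k) *\<^sub>R (matrix_power A k *v (A *v b))" for k
    by (simp add: matrix_vector_mult_scaleR matrix_vector_mul_assoc matrix_power_commute)
  ultimately show ?thesis
    using matrix_exp_vector_sums[of t A "A *v b"] sums_unique2 by fastforce
qed

text \<open>Testing against \<omega> reduces the claim to termwise differentiation of a scalar power
  series: the index shift in \<open>diffs\<close> replaces \<open>b\<close> by
  \<open>A *v b\<close>. Since the derivative has the same form, it can be iterated, which produces
  the vectors \<open>matrix_power A k *v b\<close> of the rank condition.\<close>

lemma inner_matrix_exp_has_real_derivative:
  "((\<lambda>t. \<omega> \<bullet> (matrix_exp (t *\<^sub>R A) *v b)) has_real_derivative
     \<omega> \<bullet> (matrix_exp (t *\<^sub>R A) *v (A *v b))) (at t)"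
proof -
  define c where "c b k = \<omega> \<bullet> (matrix_power A k *v b) / fact k" for b k
  have s: "(\<lambda>k. c b k * t ^ k) sums (\<omega> \<bullet> (matrix_exp (t *\<^sub>R A) *v b))" for b t
    using bounded_linear.sums[OF bounded_linear_inner_right matrix_exp_vector_sums[of t A b], of \<omega>]
    by (simp add: c_def mult_ac)
  have "((\<lambda>t. \<Sum>k. c b k * t ^ k) has_real_derivative (\<Sum>k. diffs (c b) k * t ^ k)) (at t)"
    by (rule termdiffs_strong_converges_everywhere) (use s sums_summable in blast)
  moreover have "diffs (c b) k = c (A *v b) k" for k
    by (simp add: diffs_def c_def matrix_vector_mul_assoc matrix_power_commute field_simps
        del: of_nat_Suc)
  ultimately show ?thesis
    using s by (simp add: sums_unique[symmetric, OF s])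
qed

lemma continuous_on_matrix_exp_vector:
  "continuous_on S (\<lambda>t. matrix_exp (t *\<^sub>R A) *v b)"
proof (subst continuous_on_componentwise, intro ballI)
  fix i :: "real^'a"
  have "continuous_on UNIV (\<lambda>t. i \<bullet> (matrix_exp (t *\<^sub>R A) *v b))"
    by (rule DERIV_continuous_on[OF has_field_derivative_at_within])
      (rule inner_matrix_exp_has_real_derivative)
  then show "continuous_on S (\<lambda>t. (matrix_exp (t *\<^sub>R A) *v b) \<bullet> i)"
    by (simp add: inner_commute continuous_on_subset[OF _ subset_UNIV])
qed

text \<open>With \<open>K\<close> the operator norm of \<open>A\<close>, the function
  \<open>\<parallel>e\<^sup>t\<^sup>A v\<parallel>\<^sup>2 e\<^sup>2\<^sup>K\<^sup>t\<close> is nondecreasing.\<close>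
lemma matrix_exp_vector_eq_0:
  assumes "matrix_exp (t *\<^sub>R A) *v v = 0" "t \<ge> 0"
  shows "v = 0"
proof -
  define x where "x t = matrix_exp (t *\<^sub>R A) *v v" for t
  define K where "K = onorm ((*v) A)"
  have d: "((\<lambda>t. x t $ i) has_real_derivative (A *v x t) $ i) (at t)" for i t
    using inner_matrix_exp_has_real_derivative[of "axis i 1" A v t]
    by (simp add: x_def inner_axis' matrix_exp_commute)
  \<comment> \<open>The squared norm is spelled out in coordinates so that the scalar derivatives
    \<open>d\<close> apply.\<close>
  define f where "f t = (\<Sum>i\<in>UNIV. (x t $ i)\<^sup>2) * exp (2 * K * t)" for t
  have f: "f t = (x t \<bullet> x t) * exp (2 * K * t)" for t
    by (simp add: f_def inner_vec_def power2_eq_square)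
  have "f 0 \<le> f t"
  proof (rule DERIV_nonneg_imp_nondecreasing[OF \<open>t \<ge> 0\<close>])
    fix t :: real
    let ?y = "(2 * (x t \<bullet> (A *v x t)) + 2 * K * (x t \<bullet> x t)) * exp (2 * K * t)"
    have "(f has_real_derivative ?y) (at t)"
      unfolding f_def
      by (rule derivative_eq_intros d refl | simp)+
        (simp add: inner_vec_def algebra_simps power2_eq_square sum_distrib_left)
    moreover have "\<bar>x t \<bullet> (A *v x t)\<bar> \<le> norm (x t) * (K * norm (x t))"
      unfolding K_def
      by (rule order.trans[OF Cauchy_Schwarz_ineq2 mult_left_mono[OF onorm]]) auto
    then have "?y \<ge> 0"
      by (simp add: dot_square_norm power2_eq_square mult_ac abs_le_iff)
    ultimately show "\<exists>y. (f has_real_derivative y) (at t) \<and> y \<ge> 0" by blast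
  qed
  moreover have "f t = 0"
    using assms by (simp add: f x_def)
  moreover have "x 0 = v"
  proof -
    have "(\<lambda>k. (0 ^ k / fact k) *\<^sub>R (matrix_power A k *v v)) = (\<lambda>k. if k = 0 then v else 0)"
      by (auto simp: fun_eq_iff)
    with matrix_exp_vector_sums[of 0 A v] sums_single[of 0 "\<lambda>_. v"] show ?thesis
      unfolding x_def by (auto intro: sums_unique2)
  qed
  ultimately have "v \<bullet> v \<le> 0" by (simp add: f)
  then show ?thesis by (metis inner_gt_zero_iff not_less)
qed

section \<open>The rank condition, made quantitative and uniform in time\<close>

lemma span_Kalman:
  fixes A :: "real^'n^'n"
  assumes "rank (kalman_matrix A b) = CARD('n)"
  shows "span ((\<lambda>k. matrix_power A k *v b) ` {..<CARD('n)}) = UNIV"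
proof -
  have "dim (columns (kalman_matrix A b)) = DIM(real^'n)"
    using assms by (simp add: column_rank_def)
  then show ?thesis
    by (simp only: dim_eq_full columns_kalman_matrix)
qed

text \<open>By homogeneity it suffices to treat unit vectors \<omega>. The sum is continuous on the
  compact product of the unit sphere and \<open>{0..T0}\<close>, so it attains a minimum there, and
  \<open>c\<close> is that minimum.\<close>

lemma Kalman_lower_bound:
  fixes A :: "real^'n^'n"
  assumes "rank (kalman_matrix A b) = CARD('n)" "T0 \<ge> 0"
  obtains c where "c > 0"
    "\<And>t \<omega>. t \<in> {0..T0} \<Longrightarrow>
       c * norm \<omega> \<le> (\<Sum>k<CARD('n). \<bar>\<omega> \<bullet> (matrix_exp (t *\<^sub>R A) *v (matrix_power A k *v b))\<bar>)"
proof -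
  define F where "F z = (\<Sum>k<CARD('n).
      \<bar>fst z \<bullet> (matrix_exp (snd z *\<^sub>R A) *v (matrix_power A k *v b))\<bar>)" for z :: "(real^'n) \<times> real"
  let ?S = "sphere (0::real^'n) 1 \<times> {0..T0}"
  have "continuous_on ?S (\<lambda>z. matrix_exp (snd z *\<^sub>R A) *v w)" for w
    by (rule continuous_on_compose2[OF continuous_on_matrix_exp_vector[of UNIV]])
      (auto intro: continuous_intros)
  then have "continuous_on ?S F"
    unfolding F_def by (intro continuous_intros)
  moreover have "compact ?S" by (intro compact_Times) auto
  moreover have "?S \<noteq> {}"
    using assms(2) by (auto intro!: exI[of _ "axis undefined 1"])
  ultimately obtain z where z: "z \<in> ?S" "\<And>y. y \<in> ?S \<Longrightarrow> F z \<le> F y"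
    using continuous_attains_inf[of ?S F] by blast
  obtain \<omega> t where [simp]: "z = (\<omega>, t)" by (cases z)
  \<comment> \<open>If the minimum were zero, \<omega> would be orthogonal to the image under the
    exponential of every Kalman vector, hence of the whole space. The exponential is injective and
    thus surjective, so \<omega> would be orthogonal to itself.\<close>
  have "F z \<noteq> 0"
  proof
    assume "F z = 0"
    let ?E = "\<lambda>v. matrix_exp (t *\<^sub>R A) *v v"
    from \<open>F z = 0\<close> have "\<omega> \<bullet> ?E w = 0" if "w \<in> (\<lambda>k. matrix_power A k *v b) ` {..<CARD('n)}" for w
      using that by (auto simp: F_def sum_nonneg_eq_0_iff)
    moreover have "subspace {w. \<omega> \<bullet> ?E w = 0}"
      by (auto simp: subspace_def matrix_vector_right_distrib matrix_vector_mult_scaleR inner_add_right)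
    ultimately have "span ((\<lambda>k. matrix_power A k *v b) ` {..<CARD('n)}) \<subseteq> {w. \<omega> \<bullet> ?E w = 0}"
      by (intro span_minimal) auto
    then have *: "\<omega> \<bullet> ?E w = 0" for w
      using span_Kalman[OF assms(1)] by auto
    have "inj ?E"
      using matrix_exp_vector_eq_0[of t A] z(1)
      by (subst linear_injective_0) auto
    then have "surj ?E" by (intro linear_injective_imp_surjective) auto
    then obtain w where "?E w = \<omega>" by (metis surjD)
    with *[of w] z(1) show False by auto
  qed
  moreover have "F z \<ge> 0" by (simp add: F_def sum_nonneg)
  ultimately have "F z > 0" by simp
  moreover have "F z * norm \<omega>' \<le>
      (\<Sum>k<CARD('n). \<bar>\<omega>' \<bullet> (matrix_exp (t' *\<^sub>R A) *v (matrix_power A k *v b))\<bar>)"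
    if "t' \<in> {0..T0}" for t' \<omega>'
  proof (cases "\<omega>' = 0")
    case False
    have "F z \<le> F (\<omega>' /\<^sub>R norm \<omega>', t')"
      using that False by (intro z(2)) auto
    also have "\<dots> = (\<Sum>k<CARD('n). \<bar>\<omega>' \<bullet> (matrix_exp (t' *\<^sub>R A) *v (matrix_power A k *v b))\<bar>) / norm \<omega>'"
      by (simp add: F_def abs_mult sum_distrib_left divide_inverse mult_ac)
    finally show ?thesis using False by (simp add: pos_le_divide_eq)
  qed simp
  ultimately show ?thesis by (rule that)
qed

section \<open>Sublevel sets of functions with a large derivative\<close>

text \<open>Between the points \<open>p (2i)\<close> and \<open>p (2i+1)\<close> the mean value theorem yields a
  point where the next derivative is small, and these points are still separated.\<close>
lemma no_separated_small_values:
  fixes G :: "nat \<Rightarrow> real \<Rightarrow> real" and p :: "nat \<Rightarrow> real"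
  assumes G: "\<And>k s. k < n \<Longrightarrow> (G k has_real_derivative G (Suc k) s) (at s)"
    and "\<eta> > 0"
    and "\<And>s. s \<in> {a..b} \<Longrightarrow> \<bar>G n s\<bar> \<ge> \<mu>"
    and "\<And>i. i < 2 ^ n \<Longrightarrow> p i \<in> {a..b} \<and> \<bar>G 0 (p i)\<bar> < \<mu> * \<eta> ^ n"
    and "\<And>i. Suc i < 2 ^ n \<Longrightarrow> p i + 2 * \<eta> \<le> p (Suc i)"
  shows False
  using assms
proof (induction n arbitrary: G p)
  case 0
  then show ?case by force
next
  case (Suc n)
  have "\<exists>q. i < 2 ^ n \<longrightarrow> p (2 * i) < q \<and> q < p (2 * i + 1) \<and> \<bar>G 1 q\<bar> < \<mu> * \<eta> ^ n" for i
  proof (cases "i < 2 ^ n")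
    case True
    then have i: "2 * i < 2 ^ Suc n" "2 * i + 1 < 2 ^ Suc n" by auto
    have gap: "p (2 * i) + 2 * \<eta> \<le> p (2 * i + 1)"
      using Suc.prems(5)[of "2 * i"] i by simp
    with \<open>\<eta> > 0\<close> have "p (2 * i) < p (2 * i + 1)" by simp
    from MVT2[OF this, of "G 0" "G 1"] obtain q where q: "p (2 * i) < q" "q < p (2 * i + 1)"
      and e: "G 0 (p (2 * i + 1)) - G 0 (p (2 * i)) = (p (2 * i + 1) - p (2 * i)) * G 1 q"
      using Suc.prems(1)[of 0] by auto
    \<comment> \<open>The factor 2 in the gap cancels the 2 that comes from adding the two endpoint
      values.\<close>
    have "2 * \<eta> * \<bar>G 1 q\<bar> \<le> (p (2 * i + 1) - p (2 * i)) * \<bar>G 1 q\<bar>"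
      using gap by (intro mult_right_mono) auto
    also have "\<dots> = \<bar>G 0 (p (2 * i + 1)) - G 0 (p (2 * i))\<bar>"
      unfolding e abs_mult using gap \<open>\<eta> > 0\<close> by simp
    also have "\<dots> < 2 * (\<mu> * \<eta> ^ Suc n)"
      using Suc.prems(4)[OF i(1)] Suc.prems(4)[OF i(2)] by linarith
    finally have "\<bar>G 1 q\<bar> < \<mu> * \<eta> ^ n"
      using \<open>\<eta> > 0\<close> by (simp add: mult.left_commute)
    with q show ?thesis by blast
  qed simp
  then obtain q where q: "\<And>i. i < 2 ^ n \<Longrightarrow>
      p (2 * i) < q i \<and> q i < p (2 * i + 1) \<and> \<bar>G 1 (q i)\<bar> < \<mu> * \<eta> ^ n"
    by metis
  show ?case
  proof (rule Suc.IH[of "\<lambda>k. G (Suc k)" q])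
    fix i :: nat assume i: "i < 2 ^ n"
    then have "2 * i < 2 ^ Suc n" "2 * i + 1 < 2 ^ Suc n" by auto
    with Suc.prems(4)[of "2 * i"] Suc.prems(4)[of "2 * i + 1"] q[OF i]
    show "q i \<in> {a..b} \<and> \<bar>G (Suc 0) (q i)\<bar> < \<mu> * \<eta> ^ n" by auto
  next
    fix i :: nat assume i: "Suc i < 2 ^ n"
    then have "Suc (2 * i + 1) < 2 ^ Suc n" by auto
    with Suc.prems(5)[of "2 * i + 1"] q[of i] q[of "Suc i"] i
    show "q i + 2 * \<eta> \<le> q (Suc i)" by auto
  qed (use Suc.prems in auto)
qed

text \<open>Greedy choice: take \<open>x\<close> in \<open>E\<close> within \<open>d\<close> of the
  infimum. The part of \<open>E\<close> up to \<open>x + d\<close> lies in an interval of length at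
  most \<open>2 * d\<close>. Any chain in the rest extends by \<open>x\<close> on the left, so the
  rest admits no chain of one point fewer.\<close>

lemma measure_le_of_no_separated_points:
  fixes E :: "real set"
  assumes "E \<in> lmeasurable" "bdd_below E" "d > 0"
    and "\<And>p. (\<And>i. i < n \<Longrightarrow> p i \<in> E) \<Longrightarrow> (\<And>i. Suc i < n \<Longrightarrow> p i + d \<le> p (Suc i)) \<Longrightarrow> False"
  shows "measure lebesgue E \<le> 2 * real n * d"
  using assms
proof (induction n arbitrary: E)
  case 0
  \<comment> \<open>The empty chain always exists, so the hypothesis is contradictory here.\<close>
  from "0.prems"(4)[of "\<lambda>_. 0"] show ?case by simp
next
  case (Suc n)
  show ?case
  proof (cases "E = {}")
    case False
    then obtain x where x: "x \<in> E" "x < Inf E + d"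
      using cInf_lessD[of E "Inf E + d"] Suc.prems(3) by auto
    define E' where "E' = E \<inter> {x + d..}"
    have E': "E' \<in> lmeasurable"
      unfolding E'_def using Suc.prems(1) by (intro fmeasurable_Int_fmeasurable) auto
    have "measure lebesgue E' \<le> 2 * real n * d"
    proof (rule Suc.IH)
      show "bdd_below E'" using Suc.prems(2) by (auto simp: E'_def)
      show "E' \<in> lmeasurable" "d > 0" by (fact E' Suc.prems(3))+
      fix p assume p: "\<And>i. i < n \<Longrightarrow> p i \<in> E'" "\<And>i. Suc i < n \<Longrightarrow> p i + d \<le> p (Suc i)"
      show False
      proof (rule Suc.prems(4)[of "case_nat x p"])
        fix i assume "i < Suc n"
        then show "case_nat x p i \<in> E" using p(1) x by (cases i) (auto simp: E'_def)
      next
        fix i assume "Suc i < Suc n"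
        then show "case_nat x p i + d \<le> case_nat x p (Suc i)"
          using p by (cases i) (auto simp: E'_def)
      qed
    qed
    moreover have "measure lebesgue E \<le> measure lebesgue (E' \<union> {Inf E..x + d})"
    proof (rule measure_mono_fmeasurable)
      show "E \<subseteq> E' \<union> {Inf E..x + d}"
        using cInf_lower[OF _ Suc.prems(2)] by (auto simp: E'_def)
      show "E' \<union> {Inf E..x + d} \<in> lmeasurable" using E' by (intro fmeasurable.Un) auto
    qed (use Suc.prems(1) in auto)
    moreover have "\<dots> \<le> measure lebesgue E' + measure lebesgue {Inf E..x + d}"
      using E' by (intro measure_Un_le) auto
    moreover have "measure lebesgue {Inf E..x + d} \<le> 2 * d"
      using x(2) cInf_lower[OF x(1) Suc.prems(2)] Suc.prems(3) by simp
    ultimately show ?thesis by (simp add: algebra_simps)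
  qed (use Suc.prems in auto)
qed

lemma open_sublevel_lmeasurable:
  fixes g :: "real \<Rightarrow> real"
  assumes "continuous_on UNIV g"
  shows "{s \<in> {a..b}. \<bar>g s\<bar> < r} \<in> lmeasurable"
proof -
  have "open {s. \<bar>g s\<bar> < r}"
    by (intro open_Collect_less continuous_intros assms)
  then have "{a..b} \<inter> {s. \<bar>g s\<bar> < r} \<in> lmeasurable"
    by (intro fmeasurable_Int_fmeasurable) auto
  then show ?thesis by (simp add: Int_def)
qed

text \<open>The interval is cut into at most \<open>K\<close> pieces of length at most
  \<open>1 / L\<close>. On one piece, a derivative of absolute value at least
  \<open>2 * \<mu>\<close> at the left end changes by at most \<mu>, so it stays at least \<mu>. Its
  order \<open>k < N\<close> may differ from piece to piece. Small values of \<open>G 0\<close> then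
  form no chain of \<open>2 ^ k\<close> points with gaps \<open>2 * \<eta>\<close>, which bounds the
  contribution of the piece.\<close>

lemma sublevel_measure_le:
  fixes G :: "nat \<Rightarrow> real \<Rightarrow> real"
  assumes G: "\<And>k s. (G k has_real_derivative G (Suc k) s) (at s)"
    and N: "N > 0" and \<eta>: "0 < \<eta>" "\<eta> \<le> 1" and \<mu>: "\<mu> > 0" and L: "L > 0"
    and big: "\<And>s. s \<in> {a..b} \<Longrightarrow> \<exists>k<N. \<bar>G k s\<bar> \<ge> 2 * \<mu>"
    and lip: "\<And>k s. k < N \<Longrightarrow> s \<in> {a..b} \<Longrightarrow> \<bar>G (Suc k) s\<bar> \<le> L * \<mu>"
    and K: "b - a \<le> real K / L"
  shows "measure lebesgue {s \<in> {a..b}. \<bar>G 0 s\<bar> < \<mu> * \<eta> ^ (N - 1)} \<le> K * (2 ^ (N + 1) * \<eta>)"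
proof -
  have cont: "continuous_on UNIV (G k)" for k
    by (rule DERIV_continuous_on[OF has_field_derivative_at_within]) (rule G)
  note meas = open_sublevel_lmeasurable[OF cont]
  show ?thesis
    using big lip K
  proof (induction K arbitrary: a)
    case 0
    have "measure lebesgue {s \<in> {a..b}. \<bar>G 0 s\<bar> < \<mu> * \<eta> ^ (N - 1)} \<le> measure lebesgue {a..b}"
      using meas by (intro measure_mono_fmeasurable) auto
    also have "\<dots> = 0"
      using "0.prems"(3) by (cases "a = b") auto
    finally show ?case by simp
  next
    case (Suc K)
    show ?case
    proof (cases "a \<le> b")
      case True
      define a' where "a' = min b (a + 1 / L)"
      have a': "a \<le> a'" "a' \<le> b" "a' - a \<le> 1 / L" using True L by (auto simp: a'_def)
      let ?S = "\<lambda>x y. {s \<in> {x..y}. \<bar>G 0 s\<bar> < \<mu> * \<eta> ^ (N - 1)}"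
      obtain k where k: "k < N" "\<bar>G k a\<bar> \<ge> 2 * \<mu>" using Suc.prems(1)[of a] True by auto
      have large: "\<bar>G k s\<bar> \<ge> \<mu>" if "s \<in> {a..a'}" for s
      proof (cases "s = a")
        case False
        with that have "a < s" by auto
        from MVT2[OF this, of "G k" "G (Suc k)"] G obtain z
          where z: "a < z" "z < s" "G k s - G k a = (s - a) * G (Suc k) z" by blast
        have "\<bar>G k s - G k a\<bar> \<le> (1 / L) * (L * \<mu>)"
          unfolding z(3) abs_mult using that a' z Suc.prems(2)[OF k(1), of z] L
          by (intro mult_mono) auto
        then show ?thesis using k(2) L by simp
      qed (use k \<mu> in auto)
      have "measure lebesgue (?S a a') \<le> 2 * real (2 ^ k) * (2 * \<eta>)"
      proof (rule measure_le_of_no_separated_points[OF meas])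
        fix p assume p: "\<And>i. i < 2 ^ k \<Longrightarrow> p i \<in> ?S a a'"
          "\<And>i. Suc i < 2 ^ k \<Longrightarrow> p i + 2 * \<eta> \<le> p (Suc i)"
        \<comment> \<open>Because \<open>\<eta> \<le> 1\<close>, the single threshold with exponent
          \<open>N - 1\<close> serves every order \<open>k < N\<close>.\<close>
        have "\<mu> * \<eta> ^ (N - 1) \<le> \<mu> * \<eta> ^ k"
          using k(1) \<eta> \<mu> by (intro mult_left_mono power_decreasing) auto
        then have "p i \<in> {a..a'} \<and> \<bar>G 0 (p i)\<bar> < \<mu> * \<eta> ^ k" if "i < 2 ^ k" for i
          using p(1)[OF that] by auto
        then show False
          using no_separated_small_values[of k G \<eta> a a' \<mu> p] G \<eta>(1) large p(2) by blast
      next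
        show "bdd_below (?S a a')" by (rule bdd_belowI[of _ a]) auto
      qed (use \<eta> in auto)
      also have "\<dots> \<le> 2 ^ (N + 1) * \<eta>"
      proof -
        have "(2::real) ^ Suc k \<le> 2 ^ N" using k(1) by (intro power_increasing) auto
        then show ?thesis using \<eta> by simp
      qed
      finally have 1: "measure lebesgue (?S a a') \<le> 2 ^ (N + 1) * \<eta>" .
      have 2: "measure lebesgue (?S a' b) \<le> K * (2 ^ (N + 1) * \<eta>)"
      proof (rule Suc.IH)
        show "b - a' \<le> real K / L"
          using Suc.prems(3) L by (auto simp: a'_def min_def add_divide_distrib)
      qed (use Suc.prems a' in auto)
      have *: "?S a b = ?S a a' \<union> ?S a' b" using a' by auto
      have "measure lebesgue (?S a b) \<le> measure lebesgue (?S a a') + measure lebesgue (?S a' b)"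
        unfolding * by (intro measure_Un_le fmeasurableD meas)
      also have "\<dots> \<le> 2 ^ (N + 1) * \<eta> + K * (2 ^ (N + 1) * \<eta>)"
        by (rule add_mono[OF 1 2])
      also have "\<dots> = real (Suc K) * (2 ^ (N + 1) * \<eta>)"
        by (simp only: of_nat_Suc distrib_right mult_1_left)
      finally show ?thesis .
    qed (use \<eta> in simp)
  qed
qed

section \<open>Lower bounds for integrals weighted by a switching function\<close>

lemma integrable_scaleR_continuous:
  fixes w :: "real \<Rightarrow> real" and f :: "real \<Rightarrow> 'a::euclidean_space"
  assumes "w \<in> borel_measurable (lebesgue_on {a..b})" "AE s in lebesgue_on {a..b}. \<bar>w s\<bar> \<le> C"
    and f: "continuous_on {a..b} f"
  shows "integrable (lebesgue_on {a..b}) (\<lambda>s. w s *\<^sub>R f s)"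
proof -
  interpret finite_measure "lebesgue_on {a..b}"
    by (rule finite_measure_lebesgue_on) auto
  obtain M where M: "M > 0" "\<And>s. s \<in> {a..b} \<Longrightarrow> norm (f s) \<le> M"
    using compact_imp_bounded[OF compact_continuous_image[OF f]] by (auto simp: bounded_pos)
  have fm: "f \<in> borel_measurable (lebesgue_on {a..b})"
    by (rule continuous_imp_measurable_on_sets_lebesgue[OF f]) auto
  show ?thesis
  proof (rule integrable_const_bound)
    have "AE s in lebesgue_on {a..b}. norm (f s) \<le> M" using M(2) by (intro AE_I2) auto
    with assms(2) show "AE s in lebesgue_on {a..b}. norm (w s *\<^sub>R f s) \<le> C * M"
      by eventually_elim (auto intro!: mult_mono)
  qed (use assms(1) fm in measurable)
qed

text \<open>The inequality \<open>r (\<bar>w\<bar> - 2 \<cdot> 1\<^sub>S) \<le> \<bar>g\<bar> \<bar>w\<bar>\<close> with \<open>S = {\<bar>g\<bar> < r}\<close> is integrated.\<close>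
lemma weighted_integral_ge:
  fixes g w :: "real \<Rightarrow> real"
  assumes g: "continuous_on UNIV g" and w: "w \<in> borel_measurable (lebesgue_on {a..b})"
    and w2: "AE s in lebesgue_on {a..b}. \<bar>w s\<bar> \<le> 2" and r: "r \<ge> 0"
  shows "r * ((\<integral>s. \<bar>w s\<bar> \<partial>lebesgue_on {a..b}) - 2 * measure lebesgue {s \<in> {a..b}. \<bar>g s\<bar> < r})
    \<le> (\<integral>s. \<bar>g s\<bar> * \<bar>w s\<bar> \<partial>lebesgue_on {a..b})"
proof -
  let ?S = "{s \<in> {a..b}. \<bar>g s\<bar> < r}"
  let ?M = "lebesgue_on {a..b}"
  interpret finite_measure ?M by (rule finite_measure_lebesgue_on) auto
  have S: "?S \<in> sets ?M"
    using open_sublevel_lmeasurable[OF g] by (auto simp: sets_restrict_space_iff)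
  have w': "(\<lambda>s. \<bar>w s\<bar>) \<in> borel_measurable ?M" "AE s in ?M. \<bar>\<bar>w s\<bar>\<bar> \<le> 2"
    using w w2 by auto
  have g': "continuous_on {a..b} (\<lambda>s. \<bar>g s\<bar>)"
    using continuous_on_subset[OF g] by (intro continuous_intros) auto
  have i1: "integrable ?M (\<lambda>s. \<bar>w s\<bar>)"
    using integrable_scaleR_continuous[OF w', of "\<lambda>_. 1::real"] by simp
  have i2: "integrable ?M (\<lambda>s. \<bar>g s\<bar> * \<bar>w s\<bar>)"
    using integrable_scaleR_continuous[OF w' g'] by (simp add: mult.commute)
  have i3: "integrable ?M (indicat_real ?S)"
    using S by (simp add: emeasure_eq_measure)
  have "r * ((\<integral>s. \<bar>w s\<bar> \<partial>?M) - 2 * measure lebesgue ?S)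
      = (\<integral>s. r * (\<bar>w s\<bar> - 2 * indicat_real ?S s) \<partial>?M)"
    using i1 i3 S by (simp add: measure_restrict_space sets_restrict_space_iff Int_absorb2)
  also have "\<dots> \<le> (\<integral>s. \<bar>g s\<bar> * \<bar>w s\<bar> \<partial>?M)"
  proof (rule integral_mono_AE)
    have "AE s in ?M. s \<in> {a..b}" by (intro AE_I2) auto
    with w2 show "AE s in ?M. r * (\<bar>w s\<bar> - 2 * indicat_real ?S s) \<le> \<bar>g s\<bar> * \<bar>w s\<bar>"
    proof eventually_elim
      case (elim s)
      show ?case
      proof (cases "s \<in> ?S")
        case True
        then have "r * (\<bar>w s\<bar> - 2 * indicat_real ?S s) \<le> 0"
          using elim r by (intro mult_nonneg_nonpos) auto
        also have "0 \<le> \<bar>g s\<bar> * \<bar>w s\<bar>" by simp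
        finally show ?thesis .
      next
        case False
        then have "r * \<bar>w s\<bar> \<le> \<bar>g s\<bar> * \<bar>w s\<bar>"
          using elim by (intro mult_right_mono) auto
        moreover have "indicat_real ?S s = 0" by (rule indicator_simps(2)[OF False])
        ultimately show ?thesis by simp
      qed
    qed
  qed (use i1 i2 i3 in auto)
  finally show ?thesis .
qed

text \<open>Let \<open>D\<close> be the integral of the absolute value of \<open>w\<close>. The
  threshold is tuned to \<open>D\<close> so that the set where the switching function is small has
  measure at most \<open>D / 4\<close>. As \<open>w\<close> is bounded by 2, at least half of
  \<open>D\<close> comes from outside that set, where the weight is of order
  \<open>norm \<omega> * D ^ (N - 1)\<close>.\<close>

lemma weighted_integral_lower_bound:
  fixes A :: "real^'n^'n"
  assumes rk: "rank (kalman_matrix A b) = CARD('n)" and T0: "T0 > 0"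
  shows "\<exists>c>0. \<forall>T \<omega> w. 0 < T \<longrightarrow> T \<le> T0 \<longrightarrow>
    w \<in> borel_measurable (lebesgue_on {0..T}) \<longrightarrow> (AE s in lebesgue_on {0..T}. \<bar>w s\<bar> \<le> 2) \<longrightarrow>
    c * norm \<omega> * (\<integral>s. \<bar>w s\<bar> \<partial>lebesgue_on {0..T}) ^ CARD('n)
    \<le> (\<integral>s. \<bar>\<omega> \<bullet> (matrix_exp ((T - s) *\<^sub>R A) *v b)\<bar> * \<bar>w s\<bar> \<partial>lebesgue_on {0..T})"
proof -
  let ?N = "CARD('n)"
  define F where "F k t = matrix_exp (t *\<^sub>R A) *v (matrix_power A k *v b)" for k t
  have N: "?N > 0" by simp
  obtain c0 where c0: "c0 > 0" "\<And>t \<omega>. t \<in> {0..T0} \<Longrightarrow> c0 * norm \<omega> \<le> (\<Sum>k<?N. \<bar>\<omega> \<bullet> F k t\<bar>)"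
    using Kalman_lower_bound[OF rk, of T0] T0 unfolding F_def by (metis less_imp_le)
  have "\<exists>M>0. \<forall>k\<le>?N. \<forall>t\<in>{0..T0}. norm (F k t) \<le> M"
  proof -
    have "bounded (\<Union>k\<in>{..?N}. F k ` {0..T0})"
      unfolding F_def
      by (intro bounded_UN ballI compact_imp_bounded compact_continuous_image
          continuous_on_matrix_exp_vector) auto
    then show ?thesis by (auto simp: bounded_pos)
  qed
  then obtain M where M: "M > 0" "\<And>k t. k \<le> ?N \<Longrightarrow> t \<in> {0..T0} \<Longrightarrow> norm (F k t) \<le> M" by blast
  \<comment> \<open>With \<mu> as chosen below, \<open>L * \<mu> = M * norm \<omega>\<close> bounds
    all derivatives up to order \<open>N\<close>; the ratio \<open>L\<close> is independent of
    \<omega>.\<close>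
  define L where "L = M * (2 * ?N) / c0"
  have L: "L > 0" using M c0 by (simp add: L_def)
  \<comment> \<open>\<open>K \<ge> L * T0\<close> provides enough pieces of length
    \<open>1 / L\<close>, and \<open>K \<ge> T0\<close> ensures \<open>C \<ge> T0\<close>, hence
    \<open>\<eta> \<le> 1\<close> below.\<close>
  obtain K :: nat where K: "max (L * T0) T0 \<le> K" using real_arch_simple by blast
  then have K0: "L * T0 \<le> K" "T0 \<le> K" "real K > 0" using T0 by auto
  define C where "C = real K * 2 ^ (?N + 1)"
  have C: "C > 0" using K0 by (simp add: C_def)
  have "T0 * 1 \<le> K * (2::real) ^ (?N + 1)"
    by (rule mult_mono[OF K0(2) one_le_power]) (use K0 in auto)
  then have C2: "T0 \<le> C" by (simp add: C_def)
  \<comment> \<open>Read off from \<open>\<mu> * \<eta> ^ (N - 1) * (D / 2)\<close> for the \<mu>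
    and \<eta> chosen below.\<close>
  define c where "c = c0 / (4 * ?N * (4 * C) ^ (?N - 1))"
  show ?thesis
  proof (intro exI[of _ c] conjI allI impI)
    show "c > 0" using c0 C by (simp add: c_def)
    fix T :: real and \<omega> :: "real^'n" and w :: "real \<Rightarrow> real"
    assume T: "0 < T" "T \<le> T0" and w: "w \<in> borel_measurable (lebesgue_on {0..T})"
      and w2: "AE s in lebesgue_on {0..T}. \<bar>w s\<bar> \<le> 2"
    let ?M = "lebesgue_on {0..T}"
    define D where "D = (\<integral>s. \<bar>w s\<bar> \<partial>?M)"
    have int: "integrable ?M (\<lambda>s. \<bar>w s\<bar>)"
      using integrable_scaleR_continuous[OF w w2, of "\<lambda>_. 1::real"] by simp
    have "D \<ge> 0" unfolding D_def by (rule integral_nonneg_AE) auto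
    have "D \<le> (\<integral>s. 2 \<partial>?M)"
      unfolding D_def using w2 int
      by (intro integral_mono_AE finite_measure.integrable_const finite_measure_lebesgue_on) auto
    also have "\<dots> = 2 * T" using T by (simp add: measure_restrict_space)
    finally have "D \<le> 2 * T" .
    \<comment> \<open>The sign compensates the reversal of time in \<open>T - s\<close>, so that
      each \<open>G (Suc k)\<close> is exactly the derivative of \<open>G k\<close>.\<close>
    define G where "G k s = (-1) ^ k * (\<omega> \<bullet> F k (T - s))" for k s
    have G: "(G k has_real_derivative G (Suc k) s) (at s)" for k s
    proof -
      have "((\<lambda>s. T - s) has_real_derivative -1) (at s)"
        by (auto intro!: derivative_eq_intros)
      from DERIV_chain2[OF inner_matrix_exp_has_real_derivative[of \<omega> A "matrix_power A k *v b"] this]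
      have "((\<lambda>s. \<omega> \<bullet> F k (T - s)) has_real_derivative - (\<omega> \<bullet> F (Suc k) (T - s))) (at s)"
        by (simp add: F_def matrix_vector_mul_assoc)
      from DERIV_cmult[OF this, of "(-1) ^ k"] show ?thesis
        by (simp add: G_def[abs_def])
    qed
    have Gabs: "\<bar>G k s\<bar> = \<bar>\<omega> \<bullet> F k (T - s)\<bar>" for k s
      by (simp add: G_def abs_mult power_abs)
    have cont: "continuous_on UNIV (G 0)"
      by (rule DERIV_continuous_on[OF has_field_derivative_at_within]) (rule G)
    have "c * norm \<omega> * D ^ ?N \<le> (\<integral>s. \<bar>G 0 s\<bar> * \<bar>w s\<bar> \<partial>?M)"
    proof (cases "\<omega> = 0 \<or> D = 0")
      case True
      have "(\<integral>s. \<bar>G 0 s\<bar> * \<bar>w s\<bar> \<partial>?M) \<ge> 0" by (rule integral_nonneg_AE) auto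
      with True show ?thesis by (auto simp: zero_power)
    next
      case False
      then have pos: "norm \<omega> > 0" "D > 0" using \<open>D \<ge> 0\<close> by auto
      \<comment> \<open>\<open>2 * \<mu>\<close> is an \<open>N\<close>-th of the lower bound for
        the sum of the \<open>N\<close> absolute values, so at least one of them reaches it.\<close>
      define \<mu> where "\<mu> = c0 * norm \<omega> / (2 * ?N)"
      have \<mu>: "\<mu> > 0" using c0 pos by (simp add: \<mu>_def)
      \<comment> \<open>Makes the measure bound \<open>C * \<eta>\<close> equal to
        \<open>D / 4\<close>.\<close>
      define \<eta> where "\<eta> = D / (4 * C)"
      have \<eta>: "0 < \<eta>" "\<eta> \<le> 1"
        using pos C \<open>D \<le> 2 * T\<close> T C2 by (auto simp: \<eta>_def)
      let ?S = "{s \<in> {0..T}. \<bar>G 0 s\<bar> < \<mu> * \<eta> ^ (?N - 1)}"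
      define m where "m = measure lebesgue ?S"
      have "m \<le> K * (2 ^ (?N + 1) * \<eta>)"
        unfolding m_def
      proof (rule sublevel_measure_le[of G, OF G N \<eta> \<mu> L])
        fix s assume "s \<in> {0..T}"
        then have s: "T - s \<in> {0..T0}" using T by auto
        show "\<exists>k<?N. 2 * \<mu> \<le> \<bar>G k s\<bar>"
        proof (rule ccontr)
          assume "\<not> ?thesis"
          then have "\<bar>\<omega> \<bullet> F k (T - s)\<bar> < 2 * \<mu>" if "k < ?N" for k
            using that Gabs[of k s] by force
          then have "(\<Sum>k<?N. \<bar>\<omega> \<bullet> F k (T - s)\<bar>) < (\<Sum>k<?N. 2 * \<mu>)"
            by (intro sum_strict_mono) (auto simp: lessThan_empty_iff)
          also have "\<dots> = c0 * norm \<omega>" by (simp add: \<mu>_def)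
          finally show False using c0(2)[OF s, of \<omega>] by simp
        qed
        fix k assume "k < ?N"
        then have "\<bar>G (Suc k) s\<bar> \<le> norm \<omega> * M"
          unfolding Gabs using M(2)[OF _ s, of "Suc k"]
          by (intro order.trans[OF Cauchy_Schwarz_ineq2] mult_left_mono) auto
        also have "\<dots> = L * \<mu>" using c0 by (simp add: L_def \<mu>_def)
        finally show "\<bar>G (Suc k) s\<bar> \<le> L * \<mu>" .
      next
        have "L * T \<le> K" using mult_left_mono[OF T(2), of L] L K0(1) by linarith
        then show "T - 0 \<le> real K / L" using L by (simp add: pos_le_divide_eq mult.commute)
      qed
      also have "\<dots> = C * \<eta>" by (simp only: C_def mult.assoc)
      also have "\<dots> = D / 4" using C by (simp add: \<eta>_def)
      finally have m: "D / 2 \<le> D - 2 * m" by simp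
      have eq: "c0 / (4 * n * (4 * C) ^ k) * z * D ^ Suc k = c0 * z / (2 * n) * (D / (4 * C)) ^ k * (D / 2)"
        for n z :: real and k by (simp add: power_divide mult_ac)
      have "c * norm \<omega> * D ^ ?N = \<mu> * \<eta> ^ (?N - 1) * (D / 2)"
        using eq[of "real ?N" "?N - 1" "norm \<omega>"]
        by (simp only: c_def \<mu>_def \<eta>_def Suc_diff_1[OF N])
      also have "\<dots> \<le> \<mu> * \<eta> ^ (?N - 1) * (D - 2 * m)"
        using \<mu> \<eta> by (intro mult_left_mono[OF m]) simp
      also have "\<dots> \<le> (\<integral>s. \<bar>G 0 s\<bar> * \<bar>w s\<bar> \<partial>?M)"
        unfolding D_def m_def using \<mu> \<eta> by (intro weighted_integral_ge[OF cont w w2]) auto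
      finally show ?thesis .
    qed
    then show "c * norm \<omega> * (\<integral>s. \<bar>w s\<bar> \<partial>?M) ^ ?N
        \<le> (\<integral>s. \<bar>\<omega> \<bullet> (matrix_exp ((T - s) *\<^sub>R A) *v b)\<bar> * \<bar>w s\<bar> \<partial>?M)"
      by (simp add: Gabs F_def D_def)
  qed
qed

section \<open>The reachable set\<close>

text \<open>Along the segment from \<open>x\<close> to \<open>y\<close> the linear term scales with
  \<open>t\<close> and the quadratic one with its square, so a positive inner product contradicts
  the proximal inequality for small \<open>t\<close>.\<close>

lemma proximal_normal_cone_convex:
  assumes "convex K" "x \<in> K" "y \<in> K" "\<zeta> \<in> proximal_normal_cone K x"
  shows "\<zeta> \<bullet> (y - x) \<le> 0"
proof (rule ccontr)
  define p where "p = \<zeta> \<bullet> (y - x)"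
  assume "\<not> ?thesis"
  then have p: "p > 0" by (simp add: p_def)
  obtain \<sigma> where \<sigma>: "\<sigma> \<ge> 0" "\<And>z. z \<in> K \<Longrightarrow> \<zeta> \<bullet> (z - x) \<le> \<sigma> * (norm (z - x))\<^sup>2"
    using assms(4) by (auto simp: proximal_normal_cone_def)
  define q where "q = \<sigma> * (norm (y - x))\<^sup>2"
  have q: "q \<ge> 0" using \<sigma>(1) by (simp add: q_def)
  \<comment> \<open>The \<open>1\<close> in \<open>q + 1\<close> keeps the quotient defined when
    \<open>q = 0\<close> and makes \<open>t * q < p\<close>.\<close>
  define t where "t = min 1 (p / (q + 1))"
  have t: "0 < t" "t \<le> 1" "t \<le> p / (q + 1)" using p q by (auto simp: t_def)
  have "x + t *\<^sub>R (y - x) \<in> K"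
    using convexD[OF assms(1-3), of "1 - t" t] t by (simp add: algebra_simps)
  from \<sigma>(2)[OF this] have "t * p \<le> t * (t * q)"
    by (simp add: p_def q_def power_mult_distrib power2_eq_square mult_ac)
  then have "p \<le> t * q" using t(1) by simp
  also have "\<dots> \<le> p / (q + 1) * q" using t(3) q by (rule mult_right_mono)
  also have "\<dots> < p" using p q by (simp add: field_simps)
  finally show False by simp
qed

lemma admissible_controlsD:
  assumes "u \<in> admissible_controls T"
  shows "(\<lambda>s. u s $ j) \<in> borel_measurable (lebesgue_on {0..T})"
    and "AE s in lebesgue_on {0..T}. \<bar>u s $ j\<bar> \<le> 1"
proof -
  show "(\<lambda>s. u s $ j) \<in> borel_measurable (lebesgue_on {0..T})"
    using assms by (auto simp: admissible_controls_def intro: measurable_compose[OF _ borel_measurable_nth])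
  have "AE s in lebesgue_on {0..T}. \<forall>j. u s $ j \<in> {-1..1}"
    using assms by (simp add: admissible_controls_def)
  then show "AE s in lebesgue_on {0..T}. \<bar>u s $ j\<bar> \<le> 1"
    by eventually_elim (auto simp: abs_le_iff dest: spec[of _ j])
qed

lemma admissible_controlsI:
  fixes u :: "real \<Rightarrow> real^'m"
  assumes "\<And>j. (\<lambda>s. u s $ j) \<in> borel_measurable (lebesgue_on {0..T})"
    and "\<And>j. AE s in lebesgue_on {0..T}. \<bar>u s $ j\<bar> \<le> 1"
  shows "u \<in> admissible_controls T"
proof -
  have "u \<in> borel_measurable (lebesgue_on {0..T})"
    using assms(1) by (subst borel_measurable_euclidean_space) (auto simp: Basis_vec_def inner_axis)
  moreover have "AE s in lebesgue_on {0..T}. \<forall>j. \<bar>u s $ j\<bar> \<le> 1"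
    using assms(2) by (simp add: AE_all_countable)
  then have "AE s in lebesgue_on {0..T}. \<forall>j. u s $ j \<in> {-1..1}"
    by eventually_elim (simp add: abs_le_iff minus_le_iff)
  ultimately show ?thesis by (simp add: admissible_controls_def)
qed

section \<open>The endpoint map, split into the contributions of the inputs\<close>

definition endpoint :: "real^'n^'n \<Rightarrow> real^'m^'n \<Rightarrow> real \<Rightarrow> (real \<Rightarrow> real^'m) \<Rightarrow> real^'n" where
  "endpoint A B T u =
     (\<integral>s. matrix_exp ((T - s) *\<^sub>R A) *v (B *v u s) \<partial>lebesgue_on {0..T})"

lemma reachable_set_eq: "reachable_set A B T = endpoint A B T ` admissible_controls T"
  by (auto simp: reachable_set_def endpoint_def)

text \<open>Its inner products with a covector \<omega> are the switching functions, one for each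
  input.\<close>

definition impulse_response :: "real^'n^'n \<Rightarrow> real^'m^'n \<Rightarrow> real \<Rightarrow> 'm \<Rightarrow> real \<Rightarrow> real^'n" where
  "impulse_response A B T j s = matrix_exp ((T - s) *\<^sub>R A) *v column j B"

lemma continuous_on_impulse_response: "continuous_on S (impulse_response A B T j)"
  unfolding impulse_response_def
  by (rule continuous_on_compose2[OF continuous_on_matrix_exp_vector[of UNIV]])
    (auto intro: continuous_intros)

lemma impulse_response_expansion:
  "matrix_exp ((T - s) *\<^sub>R A) *v (B *v u) = (\<Sum>j\<in>UNIV. u $ j *\<^sub>R impulse_response A B T j s)"
  unfolding matrix_mult_sum[of B u] impulse_response_def scalar_mult_eq_scaleR
  by (simp add: linear_sum[OF matrix_vector_mul_linear] matrix_vector_mult_scaleR)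

lemma integrable_endpoint_component:
  assumes "u \<in> admissible_controls T"
  shows "integrable (lebesgue_on {0..T}) (\<lambda>s. u s $ j *\<^sub>R impulse_response A B T j s)"
  by (rule integrable_scaleR_continuous[OF admissible_controlsD[OF assms] continuous_on_impulse_response])

lemma endpoint_eq_sum:
  assumes "u \<in> admissible_controls T"
  shows "endpoint A B T u =
    (\<Sum>j\<in>UNIV. \<integral>s. u s $ j *\<^sub>R impulse_response A B T j s \<partial>lebesgue_on {0..T})"
  unfolding endpoint_def impulse_response_expansion
  using integrable_endpoint_component[OF assms] by (rule Bochner_Integration.integral_sum)

lemma inner_endpoint:
  assumes "u \<in> admissible_controls T"
  shows "\<omega> \<bullet> endpoint A B T u =
    (\<Sum>j\<in>UNIV. \<integral>s. u s $ j * (\<omega> \<bullet> impulse_response A B T j s) \<partial>lebesgue_on {0..T})"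
proof -
  have "\<omega> \<bullet> (\<integral>s. u s $ j *\<^sub>R impulse_response A B T j s \<partial>lebesgue_on {0..T})
      = (\<integral>s. u s $ j * (\<omega> \<bullet> impulse_response A B T j s) \<partial>lebesgue_on {0..T})" for j
    using integral_inner_right[OF integrable_endpoint_component[OF assms], of \<omega> j A B] by simp
  then show ?thesis by (simp add: endpoint_eq_sum[OF assms] inner_sum_right)
qed

lemma integrable_control_inner:
  assumes "u \<in> admissible_controls T"
  shows "integrable (lebesgue_on {0..T}) (\<lambda>s. u s $ j * (\<omega> \<bullet> impulse_response A B T j s))"
  using integrable_inner_right[OF integrable_endpoint_component[OF assms], of \<omega> j A B] by simp

lemma norm_endpoint_diff_le:
  assumes u: "u \<in> admissible_controls T" and v: "v \<in> admissible_controls T"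
    and C: "\<And>j s. s \<in> {0..T} \<Longrightarrow> norm (impulse_response A B T j s) \<le> C"
  shows "norm (endpoint A B T v - endpoint A B T u)
    \<le> C * (\<Sum>j\<in>UNIV. \<integral>s. \<bar>v s $ j - u s $ j\<bar> \<partial>lebesgue_on {0..T})"
proof -
  let ?M = "lebesgue_on {0..T}" and ?f = "impulse_response A B T"
  have i: "integrable ?M (\<lambda>s. w s $ j)" if "w \<in> admissible_controls T" for w j
    using integrable_scaleR_continuous[OF admissible_controlsD[OF that], of "\<lambda>_. 1::real" j] by simp
  have "endpoint A B T v - endpoint A B T u = (\<Sum>j\<in>UNIV. \<integral>s. (v s $ j - u s $ j) *\<^sub>R ?f j s \<partial>?M)"
    by (simp add: endpoint_eq_sum u v scaleR_diff_left sum_subtractf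
        Bochner_Integration.integral_diff[OF integrable_endpoint_component[OF v] integrable_endpoint_component[OF u]])
  also have "norm \<dots> \<le> (\<Sum>j\<in>UNIV. C * (\<integral>s. \<bar>v s $ j - u s $ j\<bar> \<partial>?M))"
  proof (rule sum_norm_le)
    fix j
    have "norm (\<integral>s. (v s $ j - u s $ j) *\<^sub>R ?f j s \<partial>?M) \<le> (\<integral>s. C * \<bar>v s $ j - u s $ j\<bar> \<partial>?M)"
    proof (rule Bochner_Integration.integral_norm_bound_integral)
      show "integrable ?M (\<lambda>s. (v s $ j - u s $ j) *\<^sub>R ?f j s)"
        unfolding scaleR_diff_left
        by (intro Bochner_Integration.integrable_diff integrable_endpoint_component u v)
      show "integrable ?M (\<lambda>s. C * \<bar>v s $ j - u s $ j\<bar>)"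
        using i[OF u] i[OF v] by auto
      fix s assume "s \<in> space ?M"
      then have "norm (?f j s) * \<bar>v s $ j - u s $ j\<bar> \<le> C * \<bar>v s $ j - u s $ j\<bar>"
        using C by (intro mult_right_mono) auto
      then show "norm ((v s $ j - u s $ j) *\<^sub>R ?f j s) \<le> C * \<bar>v s $ j - u s $ j\<bar>"
        by (simp add: mult.commute)
    qed
    then show "norm (\<integral>s. (v s $ j - u s $ j) *\<^sub>R ?f j s \<partial>?M) \<le> C * (\<integral>s. \<bar>v s $ j - u s $ j\<bar> \<partial>?M)"
      by simp
  qed
  finally show ?thesis by (simp add: sum_distrib_left)
qed

text \<open>The endpoint is linear in the control, and the control constraint is convex. Convexity
  is used twice: for proximal normals and for separation by a hyperplane.\<close>

lemma convex_reachable_set: "convex (reachable_set A B T)"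
proof (rule convexI)
  fix x y :: "real^'a" and a b :: real
  assume xy: "x \<in> reachable_set A B T" "y \<in> reachable_set A B T" and ab: "0 \<le> a" "0 \<le> b" "a + b = 1"
  from xy obtain u v where u: "u \<in> admissible_controls T" "x = endpoint A B T u"
    and v: "v \<in> admissible_controls T" "y = endpoint A B T v"
    by (auto simp: reachable_set_eq)
  let ?w = "\<lambda>s. a *\<^sub>R u s + b *\<^sub>R v s"
  have w: "?w \<in> admissible_controls T"
  proof (rule admissible_controlsI)
    fix j
    show "(\<lambda>s. ?w s $ j) \<in> borel_measurable (lebesgue_on {0..T})"
      using admissible_controlsD(1)[OF u(1), of j] admissible_controlsD(1)[OF v(1), of j] by simp
    show "AE s in lebesgue_on {0..T}. \<bar>?w s $ j\<bar> \<le> 1"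
      using admissible_controlsD(2)[OF u(1), of j] admissible_controlsD(2)[OF v(1), of j]
    proof eventually_elim
      case (elim s)
      have "\<bar>a * u s $ j + b * v s $ j\<bar> \<le> a * \<bar>u s $ j\<bar> + b * \<bar>v s $ j\<bar>"
        using ab by (intro order.trans[OF abs_triangle_ineq]) (simp add: abs_mult)
      also have "\<dots> \<le> a * 1 + b * 1" using elim ab by (intro add_mono mult_left_mono) auto
      finally show ?case using ab by simp
    qed
  qed
  have "(\<integral>s. ?w s $ j *\<^sub>R impulse_response A B T j s \<partial>lebesgue_on {0..T})
      = a *\<^sub>R (\<integral>s. u s $ j *\<^sub>R impulse_response A B T j s \<partial>lebesgue_on {0..T})
      + b *\<^sub>R (\<integral>s. v s $ j *\<^sub>R impulse_response A B T j s \<partial>lebesgue_on {0..T})" for j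
  proof -
    have "?w s $ j *\<^sub>R impulse_response A B T j s
        = a *\<^sub>R (u s $ j *\<^sub>R impulse_response A B T j s)
        + b *\<^sub>R (v s $ j *\<^sub>R impulse_response A B T j s)" for s
      by (simp add: scaleR_add_left)
    then show ?thesis
      by (simp only: Bochner_Integration.integral_add integrable_scaleR_right integral_scaleR_right
          integrable_endpoint_component[OF u(1)] integrable_endpoint_component[OF v(1)])
  qed
  then have "endpoint A B T ?w = a *\<^sub>R x + b *\<^sub>R y"
    by (simp add: endpoint_eq_sum[OF w] endpoint_eq_sum[OF u(1)] endpoint_eq_sum[OF v(1)]
        u(2) v(2) sum.distrib scaleR_sum_right)
  with w show "a *\<^sub>R x + b *\<^sub>R y \<in> reachable_set A B T"
    by (metis imageI reachable_set_eq)
qed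

section \<open>Bang-bang controls and the support function\<close>

definition bang_bang :: "real^'n^'n \<Rightarrow> real^'m^'n \<Rightarrow> real \<Rightarrow> real^'n \<Rightarrow> real \<Rightarrow> real^'m" where
  "bang_bang A B T \<omega> s = (\<chi> j. sgn (\<omega> \<bullet> impulse_response A B T j s))"

lemma bang_bang_admissible: "bang_bang A B T \<omega> \<in> admissible_controls T"
proof (rule admissible_controlsI)
  fix j
  have "continuous_on {0..T} (\<lambda>s. \<omega> \<bullet> impulse_response A B T j s)"
    by (intro continuous_intros continuous_on_impulse_response)
  then have "(\<lambda>s. \<omega> \<bullet> impulse_response A B T j s) \<in> borel_measurable (lebesgue_on {0..T})"
    by (rule continuous_imp_measurable_on_sets_lebesgue) auto
  then show "(\<lambda>s. bang_bang A B T \<omega> s $ j) \<in> borel_measurable (lebesgue_on {0..T})"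
    unfolding bang_bang_def by simp
qed (simp add: bang_bang_def sgn_real_def)

text \<open>This is the support function of the reachable set: the sign maximises each integrand
  pointwise. At zeros of the switching function the control takes the admissible value
  \<open>sgn 0 = 0\<close>.\<close>

lemma inner_endpoint_bang_bang:
  "\<omega> \<bullet> endpoint A B T (bang_bang A B T \<omega>) =
    (\<Sum>j\<in>UNIV. \<integral>s. \<bar>\<omega> \<bullet> impulse_response A B T j s\<bar> \<partial>lebesgue_on {0..T})"
  by (simp add: inner_endpoint[OF bang_bang_admissible] bang_bang_def abs_sgn mult.commute)

text \<open>Pointwise, \<open>\<bar>g\<bar> \<bar>v - u\<bar> \<le> g (u - v) + 2 (\<bar>g\<bar> - g u)\<close>; the last term integrates to at
  most \<open>0\<close> because the bang-bang control does not beat \<open>u\<close>.\<close>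
lemma inner_endpoint_diff_le:
  assumes u: "u \<in> admissible_controls T" and v: "v \<in> admissible_controls T"
    and max: "\<And>z. z \<in> reachable_set A B T \<Longrightarrow> \<omega> \<bullet> (z - endpoint A B T u) \<le> 0"
  shows "\<omega> \<bullet> (endpoint A B T v - endpoint A B T u)
    \<le> - (\<Sum>j\<in>UNIV. \<integral>s. \<bar>\<omega> \<bullet> impulse_response A B T j s\<bar> * \<bar>v s $ j - u s $ j\<bar> \<partial>lebesgue_on {0..T})"
proof -
  let ?M = "lebesgue_on {0..T}" and ?g = "\<lambda>j s. \<omega> \<bullet> impulse_response A B T j s"
  have iu: "integrable ?M (\<lambda>s. u s $ j * ?g j s)" and iv: "integrable ?M (\<lambda>s. v s $ j * ?g j s)" for j
    by (rule integrable_control_inner[OF u], rule integrable_control_inner[OF v])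
  have ig: "integrable ?M (\<lambda>s. \<bar>?g j s\<bar>)" for j
    using integrable_control_inner[OF bang_bang_admissible[of A B T \<omega>], of j \<omega> A B]
    by (simp add: bang_bang_def abs_sgn mult.commute)
  have le: "(\<integral>s. \<bar>?g j s\<bar> * \<bar>v s $ j - u s $ j\<bar> \<partial>?M)
     \<le> (\<integral>s. 2 * \<bar>?g j s\<bar> - u s $ j * ?g j s - v s $ j * ?g j s \<partial>?M)" for j
  proof (rule integral_mono_AE)
    have "integrable ?M (\<lambda>s. \<bar>v s $ j * ?g j s - u s $ j * ?g j s\<bar>)"
      using iu iv by (intro integrable_abs Bochner_Integration.integrable_diff)
    moreover have "\<bar>v s $ j * ?g j s - u s $ j * ?g j s\<bar> = \<bar>?g j s\<bar> * \<bar>v s $ j - u s $ j\<bar>" for s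
      by (simp add: left_diff_distrib[symmetric] abs_mult)
    ultimately show "integrable ?M (\<lambda>s. \<bar>?g j s\<bar> * \<bar>v s $ j - u s $ j\<bar>)" by simp
    show "integrable ?M (\<lambda>s. 2 * \<bar>?g j s\<bar> - u s $ j * ?g j s - v s $ j * ?g j s)"
      using iu iv ig by (intro Bochner_Integration.integrable_diff integrable_mult_right)
    show "AE s in ?M. \<bar>?g j s\<bar> * \<bar>v s $ j - u s $ j\<bar>
        \<le> 2 * \<bar>?g j s\<bar> - u s $ j * ?g j s - v s $ j * ?g j s"
      using admissible_controlsD(2)[OF u, of j] admissible_controlsD(2)[OF v, of j]
    proof eventually_elim
      case (elim s)
      \<comment> \<open>This is the pointwise inequality divided by the absolute value of the
        switching function, with \<open>e\<close> its sign. For \<open>e = 1\<close> it says that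
        twice the larger of the two control values is at most 2.\<close>
      have *: "\<bar>v s $ j - u s $ j\<bar> \<le> 2 - e * u s $ j - e * v s $ j" if "e = 1 \<or> e = -1" for e
        using that elim by auto
      show ?case
      proof (cases "?g j s \<ge> 0")
        case True
        then show ?thesis using mult_left_mono[OF *[of 1], of "?g j s"] by (simp add: algebra_simps)
      next
        case False
        then show ?thesis using mult_left_mono[OF *[of "-1"], of "- ?g j s"] by (simp add: algebra_simps)
      qed
    qed
  qed
  have "endpoint A B T (bang_bang A B T \<omega>) \<in> reachable_set A B T"
    by (simp add: reachable_set_eq bang_bang_admissible)
  from max[OF this] have opt: "(\<Sum>j\<in>UNIV. \<integral>s. \<bar>?g j s\<bar> \<partial>?M) \<le> \<omega> \<bullet> endpoint A B T u"
    by (simp add: inner_diff_right inner_endpoint_bang_bang)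
  have "(\<Sum>j\<in>UNIV. \<integral>s. \<bar>?g j s\<bar> * \<bar>v s $ j - u s $ j\<bar> \<partial>?M)
      \<le> (\<Sum>j\<in>UNIV. \<integral>s. 2 * \<bar>?g j s\<bar> - u s $ j * ?g j s - v s $ j * ?g j s \<partial>?M)"
    by (rule sum_mono) (rule le)
  also have "\<dots> = 2 * (\<Sum>j\<in>UNIV. \<integral>s. \<bar>?g j s\<bar> \<partial>?M) - \<omega> \<bullet> endpoint A B T u - \<omega> \<bullet> endpoint A B T v"
    using iu iv ig by (simp add: inner_endpoint u v sum_subtractf sum_distrib_left)
  finally show ?thesis using opt by (simp add: inner_diff_right)
qed

text \<open>A point of the ball outside \<open>K\<close> would be separated from \<open>K\<close> by
  some \<open>a\<close>, forcing \<open>\<rho> * norm a \<le> r * norm a\<close>. The inequality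
  \<open>r < \<rho>\<close> is strict because convexity alone gives only weak separation.\<close>

lemma cball_subset_of_support:
  fixes K :: "'a::euclidean_space set"
  assumes "convex K" "K \<noteq> {}" "r < \<rho>"
    and supp: "\<And>\<omega>. \<exists>x\<in>K. \<rho> * norm \<omega> \<le> \<omega> \<bullet> x"
  shows "cball 0 r \<subseteq> K"
proof
  fix z :: 'a assume z: "z \<in> cball 0 r"
  show "z \<in> K"
  proof (rule ccontr)
    assume "z \<notin> K"
    then obtain a \<beta> where a: "a \<noteq> 0" "\<And>x. x \<in> K \<Longrightarrow> a \<bullet> x \<le> \<beta>" "\<beta> \<le> a \<bullet> z"
      using separating_hyperplane_sets[OF assms(1) convex_singleton[of z] assms(2)] by auto
    obtain x where "x \<in> K" "\<rho> * norm a \<le> a \<bullet> x" using supp by blast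
    then have "\<rho> * norm a \<le> a \<bullet> z" using a by force
    also have "\<dots> \<le> norm a * r"
      using z by (intro order.trans[OF norm_cauchy_schwarz] mult_left_mono) auto
    also have "\<dots> < \<rho> * norm a" using a assms(3) by (simp add: mult.commute)
    finally show False by simp
  qed
qed

section \<open>Assembly of the constants\<close>

lemma power_sum_le:
  fixes D :: "'m::finite \<Rightarrow> real"
  assumes "\<And>j. D j \<ge> 0"
  shows "(\<Sum>j\<in>UNIV. D j) ^ n \<le> CARD('m) ^ n * (\<Sum>j\<in>UNIV. D j ^ n)"
proof -
  \<comment> \<open>The largest summand controls the sum, and its power is one of the terms on the
    right.\<close>
  have "Max (range D) \<in> range D" by (intro Max_in) auto
  then obtain i where i: "Max (range D) = D i" by (rule rangeE)
  have "(\<Sum>j\<in>UNIV. D j) \<le> CARD('m) * D i"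
    using sum_bounded_above[of UNIV D "D i"] by (simp flip: i)
  then have "(\<Sum>j\<in>UNIV. D j) ^ n \<le> (CARD('m) * D i) ^ n"
    using assms by (intro power_mono sum_nonneg) auto
  also have "\<dots> = CARD('m) ^ n * D i ^ n" by (simp add: power_mult_distrib)
  also have "\<dots> \<le> CARD('m) ^ n * (\<Sum>j\<in>UNIV. D j ^ n)"
    using assms by (intro mult_left_mono member_le_sum) auto
  finally show ?thesis .
qed

text \<open>The constants are fixed before \<open>T\<close> and serve all
  \<open>0 < T \<le> T0\<close>; this uniformity controls them as \<open>T\<close> tends to
  0.\<close>

lemma normal_system_uniform_constants:
  fixes A :: "real^'n^'n" and B :: "real^'m^'n"
  assumes normal: "normal_system A B" and T0: "T0 > 0"
  obtains \<gamma> \<rho> where "\<gamma> > 0" "\<rho> > 0"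
    "\<And>T x y \<zeta>. \<lbrakk>0 < T; T \<le> T0; x \<in> reachable_set A B T; y \<in> reachable_set A B T;
       \<zeta> \<in> proximal_normal_cone (reachable_set A B T) x\<rbrakk> \<Longrightarrow>
       \<zeta> \<bullet> (y - x) \<le> - \<gamma> * norm \<zeta> * norm (y - x) ^ CARD('n)"
    "\<And>T. \<lbrakk>0 < T; T \<le> T0\<rbrakk> \<Longrightarrow> cball 0 (\<rho> * T ^ CARD('n)) \<subseteq> reachable_set A B T"
proof -
  let ?N = "CARD('n)" and ?f = "impulse_response A B"
  define Q where "Q j c \<longleftrightarrow> c > 0 \<and> (\<forall>T \<omega> w. 0 < T \<longrightarrow> T \<le> T0 \<longrightarrow>
      w \<in> borel_measurable (lebesgue_on {0..T}) \<longrightarrow> (AE s in lebesgue_on {0..T}. \<bar>w s\<bar> \<le> 2) \<longrightarrow>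
      c * norm \<omega> * (\<integral>s. \<bar>w s\<bar> \<partial>lebesgue_on {0..T}) ^ ?N
      \<le> (\<integral>s. \<bar>\<omega> \<bullet> ?f T j s\<bar> * \<bar>w s\<bar> \<partial>lebesgue_on {0..T}))" for j c
  have "\<exists>c. Q j c" for j
    using weighted_integral_lower_bound[OF normal[unfolded normal_system_def, rule_format] T0, of j]
    unfolding Q_def impulse_response_def .
  then obtain c' where Q: "\<And>j. Q j (c' j)" by metis
  then have c': "c' j > 0" for j by (simp add: Q_def)
  define c where "c = Min (range c')"
  have c0: "c > 0" using c' by (simp add: c_def)
  have c: "c * norm \<omega> * (\<integral>s. \<bar>w s\<bar> \<partial>lebesgue_on {0..T}) ^ ?N
       \<le> (\<integral>s. \<bar>\<omega> \<bullet> ?f T j s\<bar> * \<bar>w s\<bar> \<partial>lebesgue_on {0..T})"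
    if "0 < T" "T \<le> T0" "w \<in> borel_measurable (lebesgue_on {0..T})"
       "AE s in lebesgue_on {0..T}. \<bar>w s\<bar> \<le> 2" for T \<omega> w j
  proof -
    have "c \<le> c' j" by (simp add: c_def)
    then have "c * norm \<omega> * (\<integral>s. \<bar>w s\<bar> \<partial>lebesgue_on {0..T}) ^ ?N
        \<le> c' j * norm \<omega> * (\<integral>s. \<bar>w s\<bar> \<partial>lebesgue_on {0..T}) ^ ?N"
      by (intro mult_right_mono zero_le_power integral_nonneg_AE) auto
    also have "\<dots> \<le> (\<integral>s. \<bar>\<omega> \<bullet> ?f T j s\<bar> * \<bar>w s\<bar> \<partial>lebesgue_on {0..T})"
      using Q[of j] that unfolding Q_def by blast
    finally show ?thesis .
  qed
  have "bounded (\<Union>j. (\<lambda>t. matrix_exp (t *\<^sub>R A) *v column j B) ` {0..T0})"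
    by (intro bounded_UN ballI compact_imp_bounded compact_continuous_image
        continuous_on_matrix_exp_vector) auto
  then obtain C where C0: "C > 0"
    and "\<And>j t. t \<in> {0..T0} \<Longrightarrow> norm (matrix_exp (t *\<^sub>R A) *v column j B) \<le> C"
    by (auto simp: bounded_pos)
  then have C: "norm (?f T j s) \<le> C" if "T \<le> T0" "s \<in> {0..T}" for T j s
    using that by (auto simp: impulse_response_def)
  \<comment> \<open>The denominator absorbs the bound \<open>C\<close> on the impulse responses and
    the loss in \<open>power_sum_le\<close>, both to the power \<open>N\<close>.\<close>
  define \<gamma> where "\<gamma> = c / (C * CARD('m)) ^ ?N"
  show ?thesis
  proof (rule that)
    show "\<gamma> > 0" using c0 C0 by (simp add: \<gamma>_def)
    \<comment> \<open>The support function is at least \<open>c * T ^ N * norm \<omega>\<close>;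
      halving \<open>c\<close> leaves room for the strict inequality in
      \<open>cball_subset_of_support\<close>.\<close>
    show "c / 2 > 0" using c0 by simp
  next
    fix T x y \<zeta>
    assume T: "0 < T" "T \<le> T0" and xy: "x \<in> reachable_set A B T" "y \<in> reachable_set A B T"
      and \<zeta>: "\<zeta> \<in> proximal_normal_cone (reachable_set A B T) x"
    from xy obtain u v where u: "u \<in> admissible_controls T" "x = endpoint A B T u"
      and v: "v \<in> admissible_controls T" "y = endpoint A B T v"
      by (auto simp: reachable_set_eq)
    define D where "D j = (\<integral>s. \<bar>v s $ j - u s $ j\<bar> \<partial>lebesgue_on {0..T})" for j
    have D0: "D j \<ge> 0" for j unfolding D_def by (rule integral_nonneg_AE) auto
    have "norm (y - x) \<le> C * (\<Sum>j\<in>UNIV. D j)"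
      unfolding u v D_def by (rule norm_endpoint_diff_le[OF u(1) v(1) C]) (use T in auto)
    then have "norm (y - x) ^ ?N \<le> (C * (\<Sum>j\<in>UNIV. D j)) ^ ?N"
      by (intro power_mono) auto
    also have "\<dots> \<le> C ^ ?N * (CARD('m) ^ ?N * (\<Sum>j\<in>UNIV. D j ^ ?N))"
      unfolding power_mult_distrib using power_sum_le[of D ?N, OF D0] C0
      by (intro mult_left_mono) auto
    finally have "\<gamma> * norm (y - x) ^ ?N \<le> \<gamma> * (C ^ ?N * (CARD('m) ^ ?N * (\<Sum>j\<in>UNIV. D j ^ ?N)))"
      using c0 C0 by (intro mult_left_mono) (auto simp: \<gamma>_def)
    also have "\<dots> = c * (\<Sum>j\<in>UNIV. D j ^ ?N)"
      using C0 by (simp add: \<gamma>_def power_mult_distrib)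
    finally have "norm \<zeta> * (\<gamma> * norm (y - x) ^ ?N) \<le> norm \<zeta> * (c * (\<Sum>j\<in>UNIV. D j ^ ?N))"
      by (rule mult_left_mono) simp
    also have "\<dots> = (\<Sum>j\<in>UNIV. c * norm \<zeta> * D j ^ ?N)"
      by (simp add: sum_distrib_left mult_ac)
    also have "\<dots> \<le> (\<Sum>j\<in>UNIV. \<integral>s. \<bar>\<zeta> \<bullet> ?f T j s\<bar> * \<bar>v s $ j - u s $ j\<bar> \<partial>lebesgue_on {0..T})"
      unfolding D_def
    proof (intro sum_mono c T)
      fix j
      show "(\<lambda>s. v s $ j - u s $ j) \<in> borel_measurable (lebesgue_on {0..T})"
        by (intro borel_measurable_diff admissible_controlsD(1) u v)
      show "AE s in lebesgue_on {0..T}. \<bar>v s $ j - u s $ j\<bar> \<le> 2"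
        using admissible_controlsD(2)[OF u(1), of j] admissible_controlsD(2)[OF v(1), of j]
        by eventually_elim auto
    qed
    also have "\<dots> \<le> - (\<zeta> \<bullet> (y - x))"
      using inner_endpoint_diff_le[OF u(1) v(1), of A B \<zeta>]
        proximal_normal_cone_convex[OF convex_reachable_set xy(1) _ \<zeta>]
      by (simp add: u(2) v(2))
    finally show "\<zeta> \<bullet> (y - x) \<le> - \<gamma> * norm \<zeta> * norm (y - x) ^ ?N"
      by (simp add: mult_ac)
  next
    fix T assume T: "0 < T" "T \<le> T0"
    show "cball 0 (c / 2 * T ^ ?N) \<subseteq> reachable_set A B T"
    proof (rule cball_subset_of_support[OF convex_reachable_set, where \<rho> = "c * T ^ ?N"])
      show "reachable_set A B T \<noteq> {}"
        using bang_bang_admissible[of A B T] by (auto simp: reachable_set_eq)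
      show "c / 2 * T ^ ?N < c * T ^ ?N" using c0 T by auto
      fix \<omega>
      \<comment> \<open>The weight \<open>w = 1\<close> has integral \<open>T\<close>, and a single
        input already gives the bound.\<close>
      have "c * T ^ ?N * norm \<omega> \<le> (\<integral>s. \<bar>\<omega> \<bullet> ?f T j s\<bar> \<partial>lebesgue_on {0..T})" for j
        using c[OF T, of "\<lambda>_. 1" \<omega> j] T by (simp add: measure_restrict_space mult_ac)
      then have "c * T ^ ?N * norm \<omega> \<le> (\<Sum>j\<in>UNIV. \<integral>s. \<bar>\<omega> \<bullet> ?f T j s\<bar> \<partial>lebesgue_on {0..T})"
        by (rule order.trans[OF _ member_le_sum]) (auto intro: integral_nonneg_AE)
      then show "\<exists>x\<in>reachable_set A B T. c * T ^ ?N * norm \<omega> \<le> \<omega> \<bullet> x"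
        unfolding reachable_set_eq inner_endpoint_bang_bang[symmetric]
        using bang_bang_admissible by blast
    qed
  qed
qed

lemma bounded_away_from_zero_at_0I:
  assumes "r > 0" "\<And>T. 0 < T \<Longrightarrow> T \<le> 1 \<Longrightarrow> f T = r"
  shows "bounded_away_from_zero_at_0 f"
proof -
  have "\<forall>\<^sub>F T in at_right (0::real). ereal r \<le> ereal (f T)"
    using assms by (auto simp: eventually_at_right_field intro!: exI[of _ 1])
  then have "ereal r \<le> Liminf (at_right 0) (\<lambda>T. ereal (f T))" by (rule Liminf_bounded)
  with assms(1) show ?thesis
    unfolding bounded_away_from_zero_at_0_def by (metis ereal_less(2) less_le_trans)
qed

theorem theorem3p3:
  fixes A :: "real^'n^'n" and B :: "real^'m^'n"
  assumes "CARD('n) \<ge> 2" and "CARD('m) \<ge> 1" and "CARD('m) \<le> CARD('n)"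
    and "normal_system A B"
  shows "\<exists>\<gamma> \<gamma>' :: real \<Rightarrow> real.
    (\<forall>T>0. \<gamma> T > 0 \<and>
       (\<forall>x \<in> reachable_set A B T. \<forall>y \<in> reachable_set A B T.
          \<forall>\<zeta> \<in> proximal_normal_cone (reachable_set A B T) x.
            inner \<zeta> (y - x) \<le> - \<gamma> T * norm \<zeta> * norm (y - x) ^ CARD('n))) \<and>
    (\<forall>T>0. \<gamma>' T > 0 \<and> cball 0 (\<gamma>' T * T ^ CARD('n)) \<subseteq> reachable_set A B T) \<and>
    bounded_away_from_zero_at_0 \<gamma> \<and>
    bounded_away_from_zero_at_0 \<gamma>'"
proof -
  define P where "P T0 \<gamma> \<rho> \<longleftrightarrow> \<gamma> > 0 \<and> \<rho> > 0 \<and> (\<forall>T. 0 < T \<longrightarrow> T \<le> T0 \<longrightarrow>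
      (\<forall>x \<in> reachable_set A B T. \<forall>y \<in> reachable_set A B T.
          \<forall>\<zeta> \<in> proximal_normal_cone (reachable_set A B T) x.
            \<zeta> \<bullet> (y - x) \<le> - \<gamma> * norm \<zeta> * norm (y - x) ^ CARD('n)) \<and>
      cball 0 (\<rho> * T ^ CARD('n)) \<subseteq> reachable_set A B T)" for T0 \<gamma> \<rho>
  have "\<exists>\<gamma> \<rho>. P (max 1 T) \<gamma> \<rho>" for T
  proof -
    have "max 1 T > 0" by simp
    from normal_system_uniform_constants[OF assms(4) this] show ?thesis
      unfolding P_def by metis
  qed
  then obtain g h where gh: "\<And>T. P (max 1 T) (g T) (h T)" by metis
  \<comment> \<open>The choice function is evaluated at \<open>max 1 T\<close>, so \<gamma> is
    constant for \<open>T \<le> 1\<close> and hence bounded away from zero near 0.\<close>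
  define \<gamma> where "\<gamma> T = g (max 1 T)" for T
  define \<gamma>' where "\<gamma>' T = h (max 1 T)" for T
  have P: "P (max 1 T) (\<gamma> T) (\<gamma>' T)" for T
    using gh[of "max 1 T"] by (simp add: \<gamma>_def \<gamma>'_def)
  have "bounded_away_from_zero_at_0 \<gamma>"
    by (rule bounded_away_from_zero_at_0I[of "\<gamma> 1"])
      (use P[of 1] in \<open>auto simp: P_def \<gamma>_def max_def\<close>)
  moreover have "bounded_away_from_zero_at_0 \<gamma>'"
    by (rule bounded_away_from_zero_at_0I[of "\<gamma>' 1"])
      (use P[of 1] in \<open>auto simp: P_def \<gamma>'_def max_def\<close>)
  ultimately show ?thesis
    using P unfolding P_def by (intro exI[of _ \<gamma>] exI[of _ \<gamma>']) auto
qed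

end
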